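(* There exists an absolute constant $C>0$ such that the following holds. For every integer $n\ge 2$, every positive integer $m$, and all monotone utility functions $u_1,\dots,u_n:\{0,1\}^m\to\mathbb{R}$ on the set of goods $[m]$, there exist a non-negative integer $c\le C\sqrt{n\log n}$ and a partition $\{A_1,A_2\}$ of $[m]$ that is a consensus halving up to $c$ goods.
   Context: Write $[m]=\{1,\dots,m\}$. A subset $S\subseteq[m]$ is identified with its indicator vector in $\{0,1\}^m$, so a function $u:\{0,1\}^m\to\mathbb{R}$ is a real-valued set function on subsets of $[m]$. It is monotone if $u(S)\le u(S')$ whenever $S\subseteq S'\subseteq[m]$; utilities are not assumed to be additive. A partition $\{A_1,A_2\}$ of the goods means disjoint sets $A_1,A_2$ (possibly empty) with $A_1\cup A_2=[m]$. It is a consensus halving up to $c$ goods (with respect to $u_1,\dots,u_n$) if for each $i\in\{1,\dots,n\}$ there exist $R_1\subseteq A_1$ and $R_2\subseteq A_2$ (which may depend on $i$) with $|R_1|,|R_2|\le c$ such that $u_i(A_1)\ge u_i(A_2\setminus R_2)$ and $u_i(A_2)\ge u_i(A_1\setminus R_1)$. *)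

theory Defs
  imports Complex_Main
begin

text \<open>Goods are \<open>1, \<dots>, m\<close> and agents are \<open>1, \<dots>, n\<close>. A utility function on
  \<open>{0,1}\<^sup>m\<close> is a function on sets of naturals of which only the values on
  \<open>Pow {1..m}\<close> matter.\<close>

definition monotone_utility :: "nat \<Rightarrow> (nat set \<Rightarrow> real) \<Rightarrow> bool" where
  "monotone_utility m v \<longleftrightarrow> mono_on (Pow {1..m}) v"

definition partition_of_goods :: "nat \<Rightarrow> nat set \<Rightarrow> nat set \<Rightarrow> bool" where
  "partition_of_goods m A1 A2 \<longleftrightarrow> A1 \<inter> A2 = {} \<and> A1 \<union> A2 = {1..m}"

definition consensus_halving_up_to ::
    "nat \<Rightarrow> nat \<Rightarrow> (nat \<Rightarrow> nat set \<Rightarrow> real) \<Rightarrow> nat set \<Rightarrow> nat set \<Rightarrow> bool" where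
  "consensus_halving_up_to c n u A1 A2 \<longleftrightarrow>
     (\<forall>i\<in>{1..n}. \<exists>R1 R2. R1 \<subseteq> A1 \<and> R2 \<subseteq> A2 \<and> card R1 \<le> c \<and> card R2 \<le> c \<and>
        u i A1 \<ge> u i (A2 - R2) \<and> u i A2 \<ge> u i (A1 - R1))"

end

theory Submission
  imports Defs "HOL-Library.FuncSet" "HOL-Library.Multiset" "HOL-Analysis.Convex"
begin

text \<open>Measure the imbalance of a partition for one agent by a function that is monotone,
  odd under complementation, changes by at most 2 when one good moves, and whose being small
  gives a halving up to few goods. It then suffices to find a set on which \<open>n\<close> such functions all have absolute value \<open>O(sqrt (n ln n))\<close>. Split each good into \<open>q\<close> linearly ordered
  beads; a set of beads makes a random set of goods by drawing one bead of each good
  independently. Tucker's octahedral lemma, with labels given by the signs of the expectations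
  and, when these do not decide, by an alternation number, yields a set of beads for which all
  \<open>n\<close> expectations nearly vanish and at most \<open>n\<close> goods are fractional. A bounded differences
  inequality for the random set of goods, with only these \<open>n\<close> goods contributing, finishes the
  proof.\<close>

section \<open>Tucker's octahedral lemma\<close>

fun alternating :: "bool \<Rightarrow> nat list \<Rightarrow> bool" where
  "alternating s [] = True"
| "alternating s (x # xs) = (even x = s \<and> alternating (\<not> s) xs)"

definition remove_at :: "nat \<Rightarrow> 'a list \<Rightarrow> 'a list" where
  "remove_at i xs = take i xs @ drop (Suc i) xs"

text \<open>A nonempty list alternates from at most one of the two signs. If it alternates from
  \<open>s\<close>, only deleting its last entry works; if from the other sign, only deleting its
  first. Otherwise the deletions that work, if any, are those of two neighbours of equal
  sign.\<close>

lemma even_alternating_remove_at: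
  "even (\<Sum>i<length xs. of_bool (alternating s (remove_at i xs)) :: nat) \<longleftrightarrow>
     (alternating s xs \<longleftrightarrow> alternating (\<not> s) xs)"
proof (induction xs arbitrary: s)
  case (Cons x xs)
  have "(\<Sum>i<length (x # xs). of_bool (alternating s (remove_at i (x # xs))) :: nat) =
      of_bool (alternating s xs) +
      (if even x = s then \<Sum>i<length xs. of_bool (alternating (\<not> s) (remove_at i xs)) else 0)"
    by (simp add: sum.lessThan_Suc_shift remove_at_def del: sum.lessThan_Suc)
  then show ?case
    using Cons.IH[of "\<not> s"] by auto
qed simp

lemma mset_remove_at:
  assumes "i < length xs"
  shows "mset (remove_at i xs) = mset xs - {#xs ! i#}"
proof -
  have "mset xs = mset (take i xs @ xs ! i # drop (Suc i) xs)"
    using assms by (simp add: id_take_nth_drop[symmetric])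
  then show ?thesis
    by (simp add: remove_at_def)
qed

text \<open>After sorting, only the value of the deleted entry matters, so the count is a sum over
  the multiset of entries and \<open>xs\<close> may be replaced by \<open>sort xs\<close>. Deleting
  from a sorted list leaves it sorted.\<close>

lemma even_alternating_sort_remove_at:
  "even (\<Sum>i<length xs. of_bool (alternating s (sort (remove_at i xs))) :: nat) \<longleftrightarrow>
     (alternating s (sort xs) \<longleftrightarrow> alternating (\<not> s) (sort xs))"
proof -
  define g :: "nat \<Rightarrow> nat" where
    "g = (\<lambda>x. of_bool (alternating s (sorted_list_of_multiset (mset xs - {#x#}))))"
  have sum_eq: "(\<Sum>i<length ys. of_bool (alternating s (sort (remove_at i ys))) :: nat) =
      \<Sum>\<^sub># (image_mset g (mset xs))" if "mset ys = mset xs" for ys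
  proof -
    have "(\<Sum>i<length ys. of_bool (alternating s (sort (remove_at i ys))) :: nat) =
        (\<Sum>i<length ys. g (ys ! i))"
      using that
      by (intro sum.cong)
        (auto simp: g_def mset_remove_at simp flip: sorted_list_of_multiset_mset)
    also have "\<dots> = sum_list (map g ys)"
      by (simp add: sum_list_sum_nth atLeast0LessThan)
    also have "\<dots> = \<Sum>\<^sub># (image_mset g (mset xs))"
      by (simp flip: sum_mset_sum_list that)
    finally show ?thesis .
  qed
  have sorted_rem: "sorted (remove_at i (sort xs))" for i
  proof -
    have "sorted (take i (sort xs) @ drop i (sort xs))" by simp
    moreover have "set (drop (Suc i) (sort xs)) \<subseteq> set (drop i (sort xs))"
      by (simp add: set_drop_subset_set_drop)
    ultimately show ?thesis unfolding remove_at_def sorted_append by (auto simp: sorted_wrt_drop)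
  qed
  have "(\<Sum>i<length xs. of_bool (alternating s (sort (remove_at i xs))) :: nat) =
      (\<Sum>i<length (sort xs). of_bool (alternating s (sort (remove_at i (sort xs)))))"
    using sum_eq[of xs] sum_eq[of "sort xs"] by simp
  also have "\<dots> = (\<Sum>i<length (sort xs). of_bool (alternating s (remove_at i (sort xs))))"
    by (simp add: sorted_sort_id[OF sorted_rem])
  finally show ?thesis
    by (simp only: even_alternating_remove_at)
qed

section \<open>Parity counting\<close>

lemma even_sum_cong:
  fixes f g :: "'a \<Rightarrow> nat"
  shows "(\<And>x. x \<in> A \<Longrightarrow> even (f x) \<longleftrightarrow> even (g x)) \<Longrightarrow> even (sum f A) \<longleftrightarrow> even (sum g A)"
  by (induction A rule: infinite_finite_induct) auto

lemma even_card_involution: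
  assumes "finite A" "\<And>x. x \<in> A \<Longrightarrow> f x \<in> A" "\<And>x. x \<in> A \<Longrightarrow> f (f x) = x"
    "\<And>x. x \<in> A \<Longrightarrow> f x \<noteq> x"
  shows "even (card A)"
  using assms
proof (induction A rule: finite_psubset_induct)
  case (psubset A)
  show ?case
  proof (cases "A = {}")
    case False
    then obtain x where x: "x \<in> A" by blast
    let ?B = "A - {x, f x}"
    have "even (card ?B)"
    proof (rule psubset.IH)
      show "?B \<subset> A" using x by blast
      show "f y \<in> ?B" if "y \<in> ?B" for y
      proof -
        have "f y \<noteq> x" "f y \<noteq> f x"
          using that psubset.prems(2)[of y] psubset.prems(2)[OF x] by auto
        then show ?thesis using that psubset.prems(1) by blast
      qed
    qed (use psubset.prems in auto)
    moreover have "card A = card ?B + 2"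
    proof -
      have "card {x, f x} = 2" using psubset.prems(3)[OF x] by simp
      moreover have "{x, f x} \<subseteq> A" using x psubset.prems(1) by blast
      ultimately show ?thesis
        using card_Diff_subset[of "{x, f x}" A] card_mono[OF psubset.hyps, of "{x, f x}"] by simp
    qed
    ultimately show ?thesis by simp
  qed simp
qed

lemma card_filter_eq_sum: "finite A \<Longrightarrow> card {x\<in>A. P x} = (\<Sum>x\<in>A. of_bool (P x))"
  by (simp add: Int_def)

section \<open>Signed labels\<close>

text \<open>A signed label \<open>+j\<close> or \<open>-j\<close> is encoded as \<open>2 * j\<close> or \<open>2 * j + 1\<close>, so that the order on
  \<open>nat\<close> sorts labels by absolute value.\<close>
definition flip :: "nat \<Rightarrow> nat" where
  "flip x = (if even x then x + 1 else x - 1)"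

lemma even_flip [simp]: "even (flip x) \<longleftrightarrow> odd x"
  by (auto simp: flip_def)

lemma flip_div_2 [simp]: "flip x div 2 = x div 2"
  by (auto simp: flip_def elim!: oddE)

lemma eq_flip_if_div_2_eq: "x div 2 = y div 2 \<Longrightarrow> even x \<noteq> even y \<Longrightarrow> y = flip x"
  unfolding flip_def by presburger

text \<open>\<open>flip\<close> permutes each pair of labels of equal absolute value and keeps the
  order of different pairs; the second assumption excludes a reversal within one pair.\<close>

lemma flip_le:
  assumes "x \<le> y" "y \<noteq> flip x"
  shows "flip x \<le> flip y"
proof (cases "x div 2 = y div 2")
  case True
  moreover have "even x \<longleftrightarrow> even y" using True assms(2) eq_flip_if_div_2_eq by blast
  ultimately have "x = y" by presburger
  then show ?thesis by simp
next
  case False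
  then have "x div 2 < y div 2" using assms(1) by (simp add: div_le_mono order_less_le)
  then have "flip x div 2 < flip y div 2" by simp
  then show ?thesis using div_le_mono[of "flip y" "flip x" 2] by linarith
qed

lemma sort_map_flip:
  assumes "\<And>x y. x \<in> set xs \<Longrightarrow> y \<in> set xs \<Longrightarrow> y \<noteq> flip x"
  shows "sort (map flip xs) = map flip (sort xs)"
proof (rule properties_for_sort)
  have "sorted_wrt (\<lambda>x y. flip x \<le> flip y) (sort xs)"
    by (rule sorted_wrt_mono_rel[OF _ sorted_sort]) (use assms in \<open>auto intro: flip_le\<close>)
  then show "sorted (map flip (sort xs))" by (simp add: sorted_wrt_map)
qed simp

lemma alternating_map_flip: "alternating s (map flip xs) \<longleftrightarrow> alternating (\<not> s) xs"
  by (induction xs arbitrary: s) auto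

text \<open>Neighbours in the sorted list with the same absolute value would, by alternation, have
  opposite signs and so be complementary.\<close>

lemma alternating_sorted_div_2:
  assumes "alternating s xs" "sorted xs"
    and "\<And>x y. x \<in> set xs \<Longrightarrow> y \<in> set xs \<Longrightarrow> y \<noteq> flip x"
  shows "sorted_wrt (<) (map (\<lambda>x. x div 2) xs)"
  using assms
proof (induction xs arbitrary: s)
  case (Cons x xs)
  have IH: "sorted_wrt (<) (map (\<lambda>x. x div 2) xs)"
    using Cons by (intro Cons.IH[of "\<not> s"]) auto
  show ?case
  proof (cases xs)
    case (Cons y ys)
    have "x div 2 \<noteq> y div 2"
      using Cons.prems Cons eq_flip_if_div_2_eq[of x y] by auto
    moreover have "x div 2 \<le> y div 2" using Cons.prems(2) Cons by (auto intro: div_le_mono)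
    ultimately have "x div 2 < y div 2" by simp
    then show ?thesis using IH Cons by auto
  qed simp
qed simp

section \<open>Sign vectors and flags\<close>

text \<open>A sign vector is the set of its signed support. A full flag of sign vectors, each extending
  the previous one by one nonzero entry, is a signed permutation: its members are the sets of
  elements of the prefixes.\<close>
definition signed_sets :: "nat \<Rightarrow> int set set" where
  "signed_sets N = {X. X \<noteq> {} \<and> X \<subseteq> {- int N..int N} \<and> (\<forall>x\<in>X. - x \<notin> X)}"

definition flags :: "nat \<Rightarrow> int list set" where
  "flags d = {w. distinct (map abs w) \<and> abs ` set w = {1..int d}}"

definition flag_labels :: "(int set \<Rightarrow> nat) \<Rightarrow> int list \<Rightarrow> nat list" where
  "flag_labels l w = map (\<lambda>k. l (set (take (Suc k) w))) [0..<length w]"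

lemma length_flag_labels [simp]: "length (flag_labels l w) = length w"
  by (simp add: flag_labels_def)

lemma length_flags: "w \<in> flags d \<Longrightarrow> length w = d"
  unfolding flags_def using distinct_card[of "map abs w"] by simp

lemma finite_flags [simp]: "finite (flags d)"
proof (rule finite_subset)
  show "flags d \<subseteq> {w. set w \<subseteq> {- int d..int d} \<and> length w = d}"
  proof
    fix w assume w: "w \<in> flags d"
    then have "\<bar>x\<bar> \<in> {1..int d}" if "x \<in> set w" for x
      using that unfolding flags_def by blast
    then have "set w \<subseteq> {- int d..int d}" by force
    then show "w \<in> {w. set w \<subseteq> {- int d..int d} \<and> length w = d}"
      using length_flags[OF w] by simp
  qed
qed (simp add: finite_lists_length_eq)

lemma set_take_flag_signed:
  assumes "w \<in> flags d" "0 < k" "d \<le> N" "0 < d"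
  shows "set (take k w) \<in> signed_sets N"
proof -
  have bounds: "\<bar>x\<bar> \<in> {1..int d}" if "x \<in> set w" for x
    using that assms(1) by (auto simp: flags_def)
  have inj: "inj_on abs (set w)"
    using assms(1) by (simp add: flags_def distinct_map)
  have no_neg: "- x \<notin> set w" if "x \<in> set w" for x
    using inj_onD[OF inj, of x "- x"] bounds[OF that] that by auto
  have "take k w \<noteq> []" using assms length_flags[OF assms(1)] by auto
  moreover have "set (take k w) \<subseteq> set w" by (rule set_take_subset)
  moreover have "set w \<subseteq> {- int N..int N}" using bounds assms(3) by force
  ultimately show ?thesis using no_neg unfolding signed_sets_def by blast
qed

lemma in_uminus_image_iff: "x \<in> uminus ` A \<longleftrightarrow> - x \<in> A" for x :: "'a :: group_add"
  by force

lemma flags_map_uminus: "w \<in> flags d \<Longrightarrow> map uminus w \<in> flags d"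
  by (simp add: flags_def comp_def image_image)

lemma flags_append_last:
  assumes "\<bar>x\<bar> = int (Suc d)"
  shows "w @ [x] \<in> flags (Suc d) \<longleftrightarrow> w \<in> flags d"
proof -
  have *: "{1..int (Suc d)} = insert (int (Suc d)) {1..int d}" "int (Suc d) \<notin> {1..int d}" by auto
  have "w @ [x] \<in> flags (Suc d) \<longleftrightarrow> distinct (map abs w) \<and> int (Suc d) \<notin> abs ` set w \<and>
      insert (int (Suc d)) (abs ` set w) = insert (int (Suc d)) {1..int d}"
    unfolding flags_def using assms *(1) by auto
  also have "\<dots> \<longleftrightarrow> distinct (map abs w) \<and> abs ` set w = {1..int d}"
    using *(2) by (metis insert_ident)
  finally show ?thesis by (simp add: flags_def)
qed

section \<open>Flags that share a facet\<close>

definition swap_at :: "nat \<Rightarrow> 'a list \<Rightarrow> 'a list" where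
  "swap_at i w = w[i := w ! Suc i, Suc i := w ! i]"

lemma mset_swap_at: "Suc i < length w \<Longrightarrow> mset (swap_at i w) = mset w"
  unfolding swap_at_def using mset_swap[of "Suc i" w i] by (simp add: list_update_swap)

text \<open>The prefix of length \<open>Suc i\<close> is the only one that separates the two
  exchanged entries. A swap thus gives the other flag that has the same facet missing this
  set.\<close>

lemma set_take_swap_at:
  assumes "Suc i < length w" "k \<noteq> Suc i"
  shows "set (take k (swap_at i w)) = set (take k w)"
proof (cases "k \<le> i")
  case True
  then show ?thesis by (simp add: swap_at_def)
next
  case False
  then have "take k (swap_at i w) = swap_at i (take k w)"
    using assms by (simp add: swap_at_def take_update_swap)
  moreover have "Suc i < length (take k w)" using False assms by simp
  ultimately show ?thesis using arg_cong[OF mset_swap_at, of i "take k w" set_mset] by simp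
qed

lemma swap_at_swap_at: "Suc i < length w \<Longrightarrow> swap_at i (swap_at i w) = w"
  by (simp add: swap_at_def list_update_swap list_eq_iff_nth_eq nth_list_update)

lemma swap_at_in_flags:
  assumes "Suc i < length w" "w \<in> flags d"
  shows "swap_at i w \<in> flags d"
proof -
  have mset_eq: "mset (map abs (swap_at i w)) = mset (map abs w)"
    by (simp add: mset_swap_at assms(1))
  show ?thesis
    using assms(2) mset_eq_imp_distinct_iff[OF mset_eq] mset_eq_setD[OF mset_eq]
    by (simp add: flags_def)
qed

lemma remove_at_flag_labels_swap_at:
  assumes "Suc i < length w"
  shows "remove_at i (flag_labels l (swap_at i w)) = remove_at i (flag_labels l w)"
proof -
  have len: "length (swap_at i w) = length w" by (simp add: swap_at_def)
  have "flag_labels l (swap_at i w) ! k = flag_labels l w ! k" if "k < length w" "k \<noteq> i" for k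
    using that set_take_swap_at[OF assms, of "Suc k"] by (simp add: flag_labels_def len)
  then have "take i (flag_labels l (swap_at i w)) = take i (flag_labels l w)"
    "drop (Suc i) (flag_labels l (swap_at i w)) = drop (Suc i) (flag_labels l w)"
    by (auto intro!: nth_equalityI simp: len)
  then show ?thesis by (simp add: remove_at_def)
qed

text \<open>Swapping entries \<open>i\<close> and \<open>Suc i\<close> pairs the flags: it changes
  neither the remaining labels nor the set of entries, hence stays in the hemisphere.\<close>

lemma even_card_flags_remove_middle:
  assumes "Suc i < Suc d"
  shows "even (card {w \<in> flags (Suc d). int (Suc d) \<in> set w \<and> P (remove_at i (flag_labels l w))})"
proof (rule even_card_involution[where f = "swap_at i"])
  fix w assume w: "w \<in> {w \<in> flags (Suc d). int (Suc d) \<in> set w \<and> P (remove_at i (flag_labels l w))}"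
  then have len: "Suc i < length w" using length_flags assms by auto
  show "swap_at i w \<in> {w \<in> flags (Suc d). int (Suc d) \<in> set w \<and> P (remove_at i (flag_labels l w))}"
    using w swap_at_in_flags[OF len] remove_at_flag_labels_swap_at[OF len]
      arg_cong[OF mset_swap_at[OF len], of set_mset] by simp
  show "swap_at i (swap_at i w) = w" by (rule swap_at_swap_at[OF len])
  have "distinct w" using w by (auto simp: flags_def distinct_map)
  then have "w ! Suc i \<noteq> w ! i" using len by (simp add: nth_eq_iff_index_eq)
  moreover have "swap_at i w ! i = w ! Suc i" using len by (simp add: swap_at_def)
  ultimately show "swap_at i w \<noteq> w" by metis
qed simp

lemma remove_at_flag_labels_last:
  "length w = d \<Longrightarrow> remove_at d (flag_labels l (w @ [x])) = flag_labels l w"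
  by (simp add: remove_at_def flag_labels_def)

text \<open>Negating the last entry keeps all smaller sets. It pairs the flags whose last entry is
  not \<open>int (Suc d)\<close>, since that entry then stays elsewhere in the list. The others lose
  their partner to the opposite hemisphere; dropping their last entry gives exactly the flags of the
  equator.\<close>

lemma even_card_flags_remove_last:
  "even (card {w \<in> flags (Suc d). int (Suc d) \<in> set w \<and> P (remove_at d (flag_labels l w))}) \<longleftrightarrow>
   even (card {w \<in> flags d. P (flag_labels l w)})"
proof -
  let ?A = "{w \<in> flags (Suc d). int (Suc d) \<in> set w \<and> P (remove_at d (flag_labels l w))}"
  let ?B = "{w \<in> ?A. last w = int (Suc d)}"
  let ?C = "{w \<in> ?A. last w \<noteq> int (Suc d)}"
  have "even (card ?C)"
  proof (rule even_card_involution[where f = "\<lambda>w. butlast w @ [- last w]"])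
    fix w assume w: "w \<in> ?C"
    then have len: "length w = Suc d" using length_flags by auto
    then obtain v x where v: "w = v @ [x]" "length v = d"
      by (metis length_Suc_conv_rev)
    have "\<bar>x\<bar> \<in> abs ` set w" by (simp add: v)
    then have "x \<noteq> 0" using w by (auto simp: flags_def)
    then show "butlast w @ [- last w] \<noteq> w" by (simp add: v)
    show "butlast (butlast w @ [- last w]) @ [- last (butlast w @ [- last w])] = w" by (simp add: v)
    have "v @ [- x] \<in> flags (Suc d)" using w by (simp add: flags_def v)
    moreover have "int (Suc d) \<in> set v" using w by (auto simp: v)
    moreover from this have "\<bar>x\<bar> \<noteq> int (Suc d)" using w by (force simp: flags_def v)
    ultimately show "butlast w @ [- last w] \<in> ?C"
      using w by (auto simp: v remove_at_flag_labels_last[OF v(2)])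
  qed simp
  moreover have "card ?B = card {w \<in> flags d. P (flag_labels l w)}"
  proof -
    have "bij_betw (\<lambda>w. w @ [int (Suc d)]) {w \<in> flags d. P (flag_labels l w)} ?B"
    proof (rule bij_betw_imageI)
      show "inj_on (\<lambda>w. w @ [int (Suc d)]) {w \<in> flags d. P (flag_labels l w)}"
        by (simp add: inj_on_def)
      show "(\<lambda>w. w @ [int (Suc d)]) ` {w \<in> flags d. P (flag_labels l w)} = ?B"
      proof (intro equalityI subsetI)
        fix w assume "w \<in> (\<lambda>w. w @ [int (Suc d)]) ` {w \<in> flags d. P (flag_labels l w)}"
        then show "w \<in> ?B"
          using flags_append_last[of "int (Suc d)" d]
          by (auto simp: remove_at_flag_labels_last length_flags)
      next
        fix w assume w: "w \<in> ?B"
        then have len: "length w = Suc d" using length_flags by auto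
        then obtain v x where v: "w = v @ [x]" "length v = d"
          by (metis length_Suc_conv_rev)
        have "x = int (Suc d)" using w by (simp add: v)
        then show "w \<in> (\<lambda>w. w @ [int (Suc d)]) ` {w \<in> flags d. P (flag_labels l w)}"
          using w flags_append_last[of x d v] by (auto simp: v remove_at_flag_labels_last[OF v(2)])
      qed
    qed
    then show ?thesis by (rule bij_betw_same_card[symmetric])
  qed
  moreover have "card ?A = card ?B + card ?C"
  proof -
    have "?A = ?B \<union> ?C" by blast
    moreover have "card (?B \<union> ?C) = card ?B + card ?C" by (rule card_Un_disjoint) auto
    ultimately show ?thesis by presburger
  qed
  ultimately show ?thesis by simp
qed

section \<open>Ky Fan's parity theorem and Tucker's lemma\<close>

definition fan_flags :: "(int set \<Rightarrow> nat) \<Rightarrow> nat \<Rightarrow> int list set" where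
  "fan_flags l d = {w \<in> flags d. alternating True (sort (flag_labels l w))}"

context
  fixes N :: nat and l :: "int set \<Rightarrow> nat"
  assumes antipodal: "\<And>X. X \<in> signed_sets N \<Longrightarrow> l (uminus ` X) = flip (l X)"
    and no_complementary:
      "\<And>X Y. X \<in> signed_sets N \<Longrightarrow> Y \<in> signed_sets N \<Longrightarrow> X \<subseteq> Y \<Longrightarrow> l Y \<noteq> flip (l X)"
begin

text \<open>The members of a flag are nested, so the hypothesis applies to any two of them in one
  order; the other order follows because \<open>flip\<close> is an involution.\<close>

lemma flag_labels_not_complementary:
  assumes "w \<in> flags d" "d \<le> N" "x \<in> set (flag_labels l w)" "y \<in> set (flag_labels l w)"
  shows "y \<noteq> flip x"
proof -
  obtain i j where i: "x = l (set (take (Suc i) w))" "i < length w"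
    and j: "y = l (set (take (Suc j) w))" "j < length w"
    using assms(3,4) by (auto simp: flag_labels_def)
  have "0 < d" using i(2) length_flags[OF assms(1)] by simp
  then have signed: "set (take (Suc k) w) \<in> signed_sets N" for k
    using set_take_flag_signed assms by simp
  have flip_flip: "flip (flip x) = x" for x by (auto simp: flip_def)
  show ?thesis
  proof (cases "i \<le> j")
    case True
    then have "set (take (Suc i) w) \<subseteq> set (take (Suc j) w)" by (simp add: set_take_subset_set_take)
    then show ?thesis using no_complementary[OF signed signed] i j by simp
  next
    case False
    then have "set (take (Suc j) w) \<subseteq> set (take (Suc i) w)" by (simp add: set_take_subset_set_take)
    then have "x \<noteq> flip y" using no_complementary[OF signed signed] i j by simp
    then show ?thesis using flip_flip by metis
  qed
qed

lemma flag_labels_map_uminus: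
  assumes "w \<in> flags d" "d \<le> N"
  shows "flag_labels l (map uminus w) = map flip (flag_labels l w)"
proof -
  have "l (uminus ` set (take (Suc k) w)) = flip (l (set (take (Suc k) w)))" if "k < length w" for k
    using that assms length_flags[OF assms(1)] by (intro antipodal set_take_flag_signed) auto
  then show ?thesis by (simp add: flag_labels_def take_map)
qed

text \<open>Count the pairs of a flag \<open>w\<close> in the hemisphere \<open>Suc d \<in> set w\<close> and a facet of \<open>w\<close> with
  alternating labels. A facet missing a middle set lies in two such flags, one missing the
  largest set in two or, on the equator, in one; on the other hand \<open>w\<close> has an odd number of
  alternating facets iff its labels alternate, starting with either sign. Those starting with a
  negative sign are the antipodes of the positive ones in the other hemisphere.\<close>
lemma even_card_fan_flags_Suc:
  assumes "Suc d \<le> N"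
  shows "even (card (fan_flags l (Suc d))) \<longleftrightarrow> even (card (fan_flags l d))"
proof -
  let ?H = "{w \<in> flags (Suc d). int (Suc d) \<in> set w}"
  let ?alt = "\<lambda>s w. alternating s (sort (flag_labels l w))"
  let ?P = "\<lambda>i w. alternating True (sort (remove_at i (flag_labels l w)))"
  have fin: "finite ?H" by simp
  have eq: "{w \<in> ?H. Q w} = {w \<in> flags (Suc d). int (Suc d) \<in> set w \<and> Q w}" for Q by blast
  \<comment> \<open>Double counting: first by flags, then by the index of the omitted set. Indices
    below \<open>d\<close> omit a middle set, index \<open>d\<close> the largest.\<close>
  have pairs: "(\<Sum>w\<in>?H. \<Sum>i<Suc d. of_bool (?P i w) :: nat) = (\<Sum>i<Suc d. card {w \<in> ?H. ?P i w})"
    by (subst sum.swap) (simp only: card_filter_eq_sum[OF fin])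
  have "even (\<Sum>i<d. card {w \<in> ?H. ?P i w})"
    unfolding eq
    by (intro dvd_sum even_card_flags_remove_middle) simp
  moreover have "even (card {w \<in> ?H. ?P d w}) \<longleftrightarrow> even (card (fan_flags l d))"
    unfolding eq fan_flags_def by (rule even_card_flags_remove_last)
  ultimately have "even (\<Sum>w\<in>?H. \<Sum>i<Suc d. of_bool (?P i w) :: nat) \<longleftrightarrow> even (card (fan_flags l d))"
    unfolding pairs by simp
  moreover have "even (\<Sum>w\<in>?H. \<Sum>i<Suc d. of_bool (?P i w) :: nat) \<longleftrightarrow>
      even (\<Sum>w\<in>?H. of_bool (?alt True w) + of_bool (?alt False w) :: nat)"
  proof (rule even_sum_cong)
    fix w assume "w \<in> ?H"
    then have len: "length (flag_labels l w) = Suc d" using length_flags by auto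
    show "even (\<Sum>i<Suc d. of_bool (?P i w) :: nat) \<longleftrightarrow>
        even (of_bool (?alt True w) + of_bool (?alt False w) :: nat)"
      using even_alternating_sort_remove_at[of True "flag_labels l w"] unfolding len by simp
  qed
  moreover have "(\<Sum>w\<in>?H. of_bool (?alt True w) + of_bool (?alt False w) :: nat) =
      card (fan_flags l (Suc d))"
  proof -
    let ?A = "{w \<in> fan_flags l (Suc d). int (Suc d) \<in> set w}"
    let ?B = "{w \<in> fan_flags l (Suc d). int (Suc d) \<notin> set w}"
    have "bij_betw (map uminus) {w \<in> ?H. ?alt False w} ?B"
    proof (rule bij_betw_byWitness[where f' = "map uminus"])
      have neg: "?alt s (map uminus w) \<longleftrightarrow> ?alt (\<not> s) w" if "w \<in> flags (Suc d)" for s w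
        using flag_labels_not_complementary[OF that assms]
        by (simp add: flag_labels_map_uminus[OF that assms] sort_map_flip alternating_map_flip)
      have sgn: "int (Suc d) \<in> set (map uminus w) \<longleftrightarrow> int (Suc d) \<notin> set w" if "w \<in> flags (Suc d)" for w
      proof -
        have inj: "inj_on abs (set w)" using that by (simp add: flags_def distinct_map)
        have "int (Suc d) \<in> abs ` set w" using that by (simp add: flags_def)
        then obtain x where "x \<in> set w" "int (Suc d) = \<bar>x\<bar>" by blast
        then have "int (Suc d) \<in> set w \<or> - int (Suc d) \<in> set w"
          by (cases "0 \<le> x") simp_all
        moreover have "\<not> (int (Suc d) \<in> set w \<and> - int (Suc d) \<in> set w)"
          using inj_onD[OF inj, of "int (Suc d)" "- int (Suc d)"] by auto
        ultimately show ?thesis unfolding set_map in_uminus_image_iff by blast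
      qed
      show "map uminus ` {w \<in> ?H. ?alt False w} \<subseteq> ?B"
        using neg sgn flags_map_uminus by (auto simp: fan_flags_def simp del: set_map)
      show "map uminus ` ?B \<subseteq> {w \<in> ?H. ?alt False w}"
        using neg sgn flags_map_uminus by (auto simp: fan_flags_def simp del: set_map)
    qed (simp_all add: comp_def)
    then have "card {w \<in> ?H. ?alt False w} = card ?B" by (rule bij_betw_same_card)
    moreover have "{w \<in> ?H. ?alt True w} = ?A" by (auto simp: fan_flags_def)
    moreover have "card (fan_flags l (Suc d)) = card ?A + card ?B"
    proof -
      have "fan_flags l (Suc d) = ?A \<union> ?B" by blast
      moreover have "finite (fan_flags l (Suc d))" by (simp add: fan_flags_def)
      then have "card (?A \<union> ?B) = card ?A + card ?B" by (intro card_Un_disjoint) auto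
      ultimately show ?thesis by presburger
    qed
    ultimately show ?thesis by (simp only: sum.distrib card_filter_eq_sum[OF fin, symmetric])
  qed
  ultimately show ?thesis by presburger
qed

lemma odd_card_fan_flags: "d \<le> N \<Longrightarrow> odd (card (fan_flags l d))"
proof (induction d)
  case 0
  have "fan_flags l 0 = {[]}" by (auto simp: fan_flags_def flags_def flag_labels_def)
  then show ?case by simp
qed (simp add: even_card_fan_flags_Suc)

text \<open>An odd number is not zero, so some full flag has alternating labels; its
  \<open>N\<close> labels already have distinct absolute values.\<close>

theorem octahedral_tucker: "N \<le> card ((\<lambda>X. l X div 2) ` signed_sets N)"
proof (cases "N = 0")
  case False
  have "fan_flags l N \<noteq> {}" using odd_card_fan_flags[of N] by auto
  then obtain w where w: "w \<in> flags N" "alternating True (sort (flag_labels l w))"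
    by (auto simp: fan_flags_def)
  have "sorted_wrt (<) (map (\<lambda>x. x div 2) (sort (flag_labels l w)))"
    by (rule alternating_sorted_div_2[OF w(2)])
      (use flag_labels_not_complementary[OF w(1)] in auto)
  then have "distinct (map (\<lambda>x. x div 2) (sort (flag_labels l w)))"
    using strict_sorted_iff by blast
  then have "card ((\<lambda>x. x div 2) ` set (flag_labels l w)) = N"
    using distinct_card length_flags[OF w(1)] by fastforce
  moreover have "set (flag_labels l w) \<subseteq> l ` signed_sets N"
    using False set_take_flag_signed[OF w(1)] by (auto simp: flag_labels_def)
  then have "(\<lambda>x. x div 2) ` set (flag_labels l w) \<subseteq> (\<lambda>X. l X div 2) ` signed_sets N"
    by auto
  moreover have "finite (signed_sets N)"
    by (rule finite_subset[of _ "Pow {- int N..int N}"]) (auto simp: signed_sets_def)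
  ultimately show ?thesis by (metis card_mono finite_imageI)
qed simp

end

section \<open>Alternation numbers\<close>

text \<open>Because of the factor \<open>(- 1) ^ j\<close>, a constant sign vector alternates maximally, and every
  zero or sign change costs at least one.\<close>
definition twisted_sign :: "int set \<Rightarrow> nat \<Rightarrow> int" where
  "twisted_sign X j = (- 1) ^ j * (of_bool (int j \<in> X) - of_bool (- int j \<in> X))"

text \<open>The value 0 says that no nonzero sign has occurred yet. It differs from both signs, so
  \<open>alt\<close> counts the first nonzero entry.\<close>

primrec last_sign :: "int set \<Rightarrow> nat \<Rightarrow> int" where
  "last_sign X 0 = 0"
| "last_sign X (Suc k) =
     (if twisted_sign X (Suc k) = 0 then last_sign X k else twisted_sign X (Suc k))"

text \<open>The length of a longest alternating subsequence of the nonzero twisted signs, computed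
  greedily as the number of runs of equal sign.\<close>

primrec alt :: "int set \<Rightarrow> nat \<Rightarrow> nat" where
  "alt X 0 = 0"
| "alt X (Suc k) = alt X k +
     of_bool (twisted_sign X (Suc k) \<noteq> 0 \<and> twisted_sign X (Suc k) \<noteq> last_sign X k)"

lemma twisted_sign_uminus: "twisted_sign (uminus ` X) j = - twisted_sign X j"
  by (simp add: twisted_sign_def in_uminus_image_iff)

lemma last_sign_uminus: "last_sign (uminus ` X) k = - last_sign X k"
  by (induction k) (simp_all add: twisted_sign_uminus)

lemma alt_uminus: "alt (uminus ` X) k = alt X k"
  by (induction k) (simp_all add: twisted_sign_uminus last_sign_uminus)

lemma twisted_sign_mono:
  assumes "X \<subseteq> Y" "\<forall>y\<in>Y. - y \<notin> Y" "twisted_sign X j \<noteq> 0"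
  shows "twisted_sign Y j = twisted_sign X j"
  using assms unfolding twisted_sign_def by (auto simp: of_bool_def split: if_splits)

lemma last_sign_eq_0: "last_sign X k = 0 \<Longrightarrow> alt X k = 0"
  by (induction k) (auto split: if_splits)

lemma alt_pos: "last_sign X k \<noteq> 0 \<Longrightarrow> 0 < alt X k"
  by (induction k) (auto split: if_splits)

text \<open>The extra unit carries the induction. It also shows that equal alternation numbers force
  equal last signs once \<open>X\<close> has one, which keeps nested undecided sets from having
  complementary labels.\<close>

lemma alt_mono:
  assumes "X \<subseteq> Y" "\<forall>y\<in>Y. - y \<notin> Y"
  shows "alt X k + of_bool (last_sign X k \<noteq> 0 \<and> last_sign Y k \<noteq> last_sign X k) \<le> alt Y k"
proof (induction k)
  case (Suc k)
  show ?case
  proof (cases "twisted_sign X (Suc k) = 0")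
    case True
    then show ?thesis using Suc by (auto split: if_splits)
  next
    case False
    then have "twisted_sign Y (Suc k) = twisted_sign X (Suc k)"
      by (rule twisted_sign_mono[OF assms])
    \<comment> \<open>Both sets see the same new sign. If only \<open>X\<close> gains,
      \<open>Y\<close> already ended in it, and the extra unit pays; if \<open>X\<close> had no sign
      before, \<open>alt X k\<close> is 0 while \<open>alt Y k\<close> is positive.\<close>
    then show ?thesis
      using Suc False last_sign_eq_0[of X k] alt_pos[of Y k]
      by (cases "last_sign X k = 0") (auto split: if_splits)
  qed
qed simp

lemma last_sign_neq_0:
  assumes "X \<in> signed_sets N"
  shows "last_sign X N \<noteq> 0"
proof -
  obtain x where x: "x \<in> X" "- x \<notin> X" "x \<noteq> 0" "\<bar>x\<bar> \<le> int N"
  proof -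
    obtain x where "x \<in> X" "\<forall>x\<in>X. - x \<notin> X" "x \<in> {- int N..int N}"
      using assms unfolding signed_sets_def by blast
    then show thesis using that[of x] by (cases "x = 0") auto
  qed
  then have "twisted_sign X (nat \<bar>x\<bar>) \<noteq> 0"
    by (cases "0 \<le> x") (auto simp: twisted_sign_def)
  moreover have "nat \<bar>x\<bar> \<le> N" "0 < nat \<bar>x\<bar>" using x by auto
  moreover have "last_sign X k \<noteq> 0" if "0 < j" "j \<le> k" "twisted_sign X j \<noteq> 0" for j k
    using that by (induction k) (auto simp: le_Suc_eq)
  ultimately show ?thesis by blast
qed

section \<open>Breaks of the alternation\<close>

definition breaks :: "int set \<Rightarrow> nat \<Rightarrow> nat set" where
  "breaks X k = {j \<in> {1..k}. alt X j = alt X (j - 1)}"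

lemma card_breaks: "alt X k + card (breaks X k) = k"
proof (induction k)
  case (Suc k)
  have *: "breaks X (Suc k) =
      (if alt X (Suc k) = alt X k then insert (Suc k) (breaks X k) else breaks X k)"
    by (auto simp: breaks_def le_Suc_eq)
  have "finite (breaks X k)" "Suc k \<notin> breaks X k" by (simp_all add: breaks_def)
  then show ?case using Suc unfolding * by auto
qed (simp add: breaks_def)

lemma alt_Suc_neq:
  "alt X (Suc k) \<noteq> alt X k \<longleftrightarrow> twisted_sign X (Suc k) \<noteq> 0 \<and> twisted_sign X (Suc k) \<noteq> last_sign X k"
  by simp

lemma zero_in_breaks:
  assumes "j \<in> {1..k}" "int j \<notin> X" "- int j \<notin> X"
  shows "j \<in> breaks X k"
proof -
  have "twisted_sign X j = 0" using assms by (simp add: twisted_sign_def)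
  then have "alt X j = alt X (j - 1)" using assms(1) by (cases j) auto
  then show ?thesis using assms(1) by (simp add: breaks_def)
qed

text \<open>Without a break at either position the twisted signs are nonzero and opposite; the
  factor \<open>(- 1) ^ j\<close> also changes, so the original signs agree.\<close>

lemma sign_change_in_breaks:
  assumes "j \<in> {1..<k}" "j \<notin> breaks X k" "Suc j \<notin> breaks X k"
  shows "int (Suc j) \<in> X \<longleftrightarrow> int j \<in> X"
proof -
  obtain i where i: "j = Suc i" using assms(1) by (cases j) auto
  have "twisted_sign X j \<noteq> 0" "last_sign X j = twisted_sign X j"
    using assms(1,2) alt_Suc_neq[of X i] by (auto simp: breaks_def i simp del: alt.simps)
  moreover have "twisted_sign X (Suc j) \<noteq> 0" "twisted_sign X (Suc j) \<noteq> last_sign X j"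
    using assms(1,3) alt_Suc_neq[of X j] by (auto simp: breaks_def simp del: alt.simps)
  ultimately have nz: "twisted_sign X j \<noteq> 0" "twisted_sign X (Suc j) \<noteq> 0"
    "twisted_sign X (Suc j) \<noteq> twisted_sign X j" by simp_all
  then show ?thesis
    unfolding twisted_sign_def
    by (auto simp: minus_one_power_iff of_bool_def simp del: of_nat_Suc split: if_splits)
qed

text \<open>Neighbours agree, so all agree. For the beads of one good this means that a good without
  breaks is not split.\<close>

lemma interval_constant:
  assumes "{a<..b} \<inter> breaks X k = {}" "b \<le> k"
  shows "(\<forall>j\<in>{a<..b}. int j \<in> X) \<or> (\<forall>j\<in>{a<..b}. int j \<notin> X)"
proof -
  have "int (Suc a + i) \<in> X \<longleftrightarrow> int (Suc a) \<in> X" if "Suc a + i \<le> b" for i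
    using that
  proof (induction i)
    case (Suc i)
    have "int (Suc (Suc a + i)) \<in> X \<longleftrightarrow> int (Suc a + i) \<in> X"
      using Suc.prems assms
      by (intro sign_change_in_breaks[where k = k]) (auto simp: disjoint_iff)
    then show ?case using Suc by simp
  qed simp
  then have "int j \<in> X \<longleftrightarrow> int (Suc a) \<in> X" if "j \<in> {a<..b}" for j
    using that le_Suc_ex[of "Suc a" j] by (metis Suc_leI greaterThanAtMost_iff)
  then show ?thesis by blast
qed

definition positive_part :: "int set \<Rightarrow> nat set" where
  "positive_part X = {j. int j \<in> X}"

text \<open>A signed set on which some \<open>F i\<close> is already decided positive or negative, however the
  remaining elements are distributed, gets the label \<open>i\<close>; the others are labelled by their
  twisted alternation number. Monotonicity excludes complementary labels, so by Tucker's lemma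
  there is an undecided set with too large an alternation number to be labelled.\<close>
theorem undecided_with_few_breaks:
  fixes F :: "nat \<Rightarrow> nat set \<Rightarrow> real"
  assumes mono: "\<And>i. i < n \<Longrightarrow> mono_on (Pow {1..N}) (F i)"
    and odd: "\<And>i B. i < n \<Longrightarrow> B \<subseteq> {1..N} \<Longrightarrow> F i ({1..N} - B) = - F i B"
    and "n < N"
  obtains X where "X \<in> signed_sets N" "card (breaks X N) \<le> n"
    "\<And>i. i < n \<Longrightarrow> F i (positive_part X) \<le> 0"
    "\<And>i. i < n \<Longrightarrow> F i (positive_part (uminus ` X)) \<le> 0"
proof -
  have even_of_bool: "even (of_bool b :: nat) \<longleftrightarrow> \<not> b" for b by simp
  let ?pos = "\<lambda>X i. i < n \<and> F i (positive_part X) > 0"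
  let ?neg = "\<lambda>X i. ?pos (uminus ` X) i"
  define good where "good X \<longleftrightarrow> (\<forall>i<n. \<not> ?pos X i \<and> \<not> ?neg X i)" for X
  define idx where "idx X = (LEAST i. ?pos X i \<or> ?neg X i)" for X
  \<comment> \<open>The offset \<open>n\<close> separates undecided sets from decided ones, whose
    index is below \<open>n\<close>. The sign is that of the last twisted entry or of the decided
    value, both reversed by negation.\<close>
  define l where "l X = (if good X then 2 * (n + alt X N) + of_bool (last_sign X N < 0)
      else 2 * idx X + of_bool (\<not> ?pos X (idx X)))" for X
  have uminus_uminus: "uminus ` uminus ` X = X" for X :: "int set" by (simp add: image_image)
  have idx: "?pos X (idx X) \<or> ?neg X (idx X)" if "\<not> good X" for X
    unfolding idx_def using that good_def by (metis (mono_tags, lifting) LeastI)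
  have good_uminus: "good (uminus ` X) \<longleftrightarrow> good X" for X
    unfolding good_def uminus_uminus by blast
  have idx_uminus: "idx (uminus ` X) = idx X" for X
    unfolding idx_def uminus_uminus by (simp add: disj_commute)
  have signed: "Y \<subseteq> {- int N..int N}" "\<And>y. y \<in> Y \<Longrightarrow> - y \<notin> Y" if "Y \<in> signed_sets N" for Y
    using that by (auto simp: signed_sets_def)
  have signed_uminus: "uminus ` Y \<in> signed_sets N" if "Y \<in> signed_sets N" for Y
    using that by (fastforce simp: signed_sets_def)
  have pos_sub: "positive_part Y \<subseteq> {1..N}" if "Y \<in> signed_sets N" for Y
  proof
    fix j assume j: "j \<in> positive_part Y"
    then have "int j \<in> Y" by (simp add: positive_part_def)
    then show "j \<in> {1..N}" using signed(1)[OF that] signed(2)[OF that, of 0] by (cases j) auto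
  qed
  \<comment> \<open>The complement of the negative part of \<open>Y\<close> contains the positive
    part of \<open>X\<close>: monotonicity makes \<open>F i\<close> positive there, oddness and
    \<open>?neg Y i\<close> make it negative.\<close>
  have not_both: False if "X \<in> signed_sets N" "Y \<in> signed_sets N" "X \<subseteq> Y" "?pos X i" "?neg Y i" for X Y i
  proof -
    have "positive_part X \<subseteq> {1..N} - positive_part (uminus ` Y)"
      using pos_sub[OF that(1)] signed(2)[OF that(2)] that(3) by (auto simp: positive_part_def)
    then have "F i (positive_part X) \<le> F i ({1..N} - positive_part (uminus ` Y))"
      using that(4) by (intro mono_onD[OF mono]) auto
    also have "\<dots> = - F i (positive_part (uminus ` Y))"
      using that(4) pos_sub[OF signed_uminus[OF that(2)]] by (intro odd) auto
    finally show False using that(4,5) by simp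
  qed
  have antipodal: "l (uminus ` X) = flip (l X)" if X: "X \<in> signed_sets N" for X
  proof (cases "good X")
    case True
    then show ?thesis
      using last_sign_neq_0[OF X]
      by (simp add: l_def good_uminus alt_uminus last_sign_uminus flip_def)
  next
    case False
    have "?pos X (idx X) \<longleftrightarrow> \<not> ?neg X (idx X)"
      using idx[OF False] not_both[OF X X order_refl] by blast
    then show ?thesis
      using False by (auto simp: l_def good_uminus idx_uminus flip_def)
  qed
  have div_2: "l X div 2 = (if good X then n + alt X N else idx X)" for X
    by (simp add: l_def)
  have idx_less: "idx X < n" if "\<not> good X" for X using idx[OF that] by blast
  have no_complementary: "l Y \<noteq> flip (l X)"
    if X: "X \<in> signed_sets N" and Y: "Y \<in> signed_sets N" and "X \<subseteq> Y" for X Y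
  proof
    assume eq: "l Y = flip (l X)"
    then have div_eq: "l Y div 2 = l X div 2" and parity: "even (l Y) \<longleftrightarrow> odd (l X)" by simp_all
    show False
    proof (cases "good X")
      case True
      then have "good Y" using div_eq idx_less[of Y] by (auto simp: div_2 split: if_splits)
      with True div_eq have "alt Y N = alt X N" by (simp add: div_2)
      then have "last_sign Y N = last_sign X N"
        using alt_mono[of X Y N] last_sign_neq_0[OF X] signed(2)[OF Y] \<open>X \<subseteq> Y\<close>
        by (auto split: if_splits)
      then show False
        using parity True \<open>good Y\<close> by (cases "last_sign X N < 0") (simp_all add: l_def)
    next
      case False
      then have "\<not> good Y" using div_eq idx_less[of X] by (auto simp: div_2 split: if_splits)
      with False div_eq have i: "idx Y = idx X" by (simp add: div_2)
      show False
      proof (cases "?pos X (idx X)")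
        case True
        then have "?neg Y (idx X)" using parity False \<open>\<not> good Y\<close> i idx[of Y] by (auto simp: l_def)
        then show False using not_both[OF X Y \<open>X \<subseteq> Y\<close> True] by blast
      next
        case nonpos: False
        then have "?pos Y (idx X)" "?neg X (idx X)"
          using parity False \<open>\<not> good Y\<close> i idx[of X]
          by (auto simp: l_def even_of_bool)
        moreover have "uminus ` X \<subseteq> uminus ` Y" using \<open>X \<subseteq> Y\<close> by blast
        ultimately show False
          using not_both[OF signed_uminus[OF X] signed_uminus[OF Y], of "idx X"]
          unfolding uminus_uminus by blast
      qed
    qed
  qed
  have "\<exists>X\<in>signed_sets N. good X \<and> card (breaks X N) \<le> n"
  proof (rule ccontr)
    assume none: "\<not> ?thesis"
    \<comment> \<open>More than \<open>n\<close> breaks keep \<open>n + alt X N\<close> below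
      \<open>N\<close>, and a positive alternation number avoids \<open>n\<close> itself. So only
      \<open>N - 1\<close> absolute values remain, one too few for Tucker's lemma.\<close>
    have "(\<lambda>X. l X div 2) ` signed_sets N \<subseteq> {..<n} \<union> {n<..<N}"
    proof
      fix k assume "k \<in> (\<lambda>X. l X div 2) ` signed_sets N"
      then obtain X where X: "X \<in> signed_sets N" "k = l X div 2" by blast
      show "k \<in> {..<n} \<union> {n<..<N}"
      proof (cases "good X")
        case True
        then have "n < card (breaks X N)" using none X(1) by auto
        then have "n + alt X N < N" using card_breaks[of X N] by simp
        moreover have "0 < alt X N"
          using alt_pos[OF last_sign_neq_0[OF X(1)]] .
        ultimately show ?thesis using True by (simp add: X(2) div_2)
      qed (use idx_less X in \<open>simp add: div_2\<close>)
    qed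
    then have "card ((\<lambda>X. l X div 2) ` signed_sets N) \<le> card ({..<n} \<union> {n<..<N})"
      by (intro card_mono) auto
    also have "\<dots> \<le> card {..<n} + card {n<..<N}" by (rule card_Un_le)
    also have "\<dots> < N" using \<open>n < N\<close> by simp
    finally show False
      using octahedral_tucker[of N l] antipodal no_complementary by fastforce
  qed
  then show thesis using that unfolding good_def by (meson not_less)
qed

section \<open>An odd Lipschitz measure of envy\<close>

definition worst_removal :: "(nat set \<Rightarrow> real) \<Rightarrow> nat \<Rightarrow> nat set \<Rightarrow> real" where
  "worst_removal v k S = Min ((\<lambda>R. v (S - R)) ` {R. R \<subseteq> S \<and> card R \<le> k})"

lemma worst_removal_le:
  assumes "finite S" "R \<subseteq> S" "card R \<le> k"
  shows "worst_removal v k S \<le> v (S - R)"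
  unfolding worst_removal_def using assms by (intro Min_le) auto

lemma worst_removal_attained:
  assumes "finite S"
  obtains R where "R \<subseteq> S" "card R \<le> k" "worst_removal v k S = v (S - R)"
proof -
  have "{} \<in> {R. R \<subseteq> S \<and> card R \<le> k}" by simp
  then have "worst_removal v k S \<in> (\<lambda>R. v (S - R)) ` {R. R \<subseteq> S \<and> card R \<le> k}"
    unfolding worst_removal_def using assms by (intro Min_in) (auto simp del: empty_iff)
  then show thesis using that by blast
qed

text \<open>As functions of \<open>x\<close>, \<open>worst_removal v x A\<close> decreases and \<open>worst_removal v (K - x) (G - A)\<close>
  increases; \<open>envy\<close> locates their crossing. Moving a good shifts both by at most one step, hence
  the Lipschitz bound, and a crossing inside \<open>{0..K}\<close> bounds envy in both directions.\<close>
definition envy :: "(nat set \<Rightarrow> real) \<Rightarrow> nat \<Rightarrow> nat set \<Rightarrow> nat set \<Rightarrow> real" where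
  "envy v K G A = (\<Sum>x\<le>K. sgn (worst_removal v x A - worst_removal v (K - x) (G - A)))"

lemma sgn_mono_real: "x \<le> y \<Longrightarrow> sgn x \<le> sgn y" for x y :: real
  by (auto simp: sgn_if)

context
  fixes v :: "nat set \<Rightarrow> real" and G :: "nat set"
  assumes finite_goods: "finite G" and mono: "mono_on (Pow G) v"
begin

text \<open>An optimal removal \<open>R\<close> from the larger set acts on the smaller one as
  \<open>R \<inter> S\<close>.\<close>

lemma worst_removal_mono:
  assumes "S \<subseteq> T" "T \<subseteq> G"
  shows "worst_removal v k S \<le> worst_removal v k T"
proof -
  have fin: "finite T" "finite S" using assms finite_goods by (auto intro: finite_subset)
  obtain R where R: "R \<subseteq> T" "card R \<le> k" "worst_removal v k T = v (T - R)"
    using worst_removal_attained[OF fin(1)] .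
  have "card (R \<inter> S) \<le> k" using R fin by (meson card_mono finite_subset inf_le1 order_trans)
  then have "worst_removal v k S \<le> v (S - R \<inter> S)" using fin by (intro worst_removal_le) auto
  also have "\<dots> \<le> v (T - R)" using assms by (intro mono_onD[OF mono]) auto
  finally show ?thesis using R by simp
qed

text \<open>The additional removal is spent on \<open>g\<close>.\<close>

lemma worst_removal_Suc_insert:
  assumes "S \<subseteq> G" "g \<notin> S"
  shows "worst_removal v (Suc k) (insert g S) \<le> worst_removal v k S"
proof -
  have fin: "finite S" using assms finite_goods by (auto intro: finite_subset)
  obtain R where R: "R \<subseteq> S" "card R \<le> k" "worst_removal v k S = v (S - R)"
    using worst_removal_attained[OF fin] .
  have "card (insert g R) \<le> Suc k" using R(2) card_insert_le_m1[of "Suc k" R g] by simp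
  then have "worst_removal v (Suc k) (insert g S) \<le> v (insert g S - insert g R)"
    using fin R by (intro worst_removal_le) auto
  also have "insert g S - insert g R = S - R" using assms by auto
  finally show ?thesis using R by simp
qed

text \<open>Reversing the summation by \<open>x \<mapsto> K - x\<close> exchanges the two bundles
  and negates every term.\<close>

lemma envy_complement:
  assumes "A \<subseteq> G"
  shows "envy v K G (G - A) = - envy v K G A"
proof -
  have *: "G - (G - A) = A" using assms by blast
  have "envy v K G (G - A) =
      (\<Sum>x\<le>K. sgn (worst_removal v (K - x) (G - A) - worst_removal v (K - (K - x)) A))"
    unfolding envy_def * by (rule sum.reindex_bij_witness[of _ "\<lambda>x. K - x" "\<lambda>x. K - x"]) auto
  also have "\<dots> = (\<Sum>x\<le>K. - sgn (worst_removal v x A - worst_removal v (K - x) (G - A)))"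
    by (intro sum.cong) (auto simp flip: sgn_minus)
  finally show ?thesis by (simp add: envy_def sum_negf)
qed

lemma envy_mono:
  assumes "A \<subseteq> B" "B \<subseteq> G"
  shows "envy v K G A \<le> envy v K G B"
  unfolding envy_def
  using assms by (intro sum_mono sgn_mono_real diff_mono worst_removal_mono) auto

text \<open>Term \<open>Suc x\<close> for the larger set is at most term \<open>x\<close> for
  \<open>A\<close>, since one unit of removal compensates for \<open>g\<close> on either side. The
  unmatched terms, 0 for the new set and \<open>K\<close> for the old, cost at most 1 each.\<close>

lemma envy_insert_le:
  assumes "A \<subseteq> G" "g \<in> G" "g \<notin> A"
  shows "envy v K G (insert g A) \<le> envy v K G A + 2"
proof -
  define t where "t B x = sgn (worst_removal v x B - worst_removal v (K - x) (G - B))" for B x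
  have envy_eq: "envy v K G B = (\<Sum>x\<le>K. t B x)" for B
    by (simp add: envy_def t_def)
  have shift: "t (insert g A) (Suc x) \<le> t A x" if "x < K" for x
  proof -
    have "worst_removal v (Suc (K - Suc x)) (insert g (G - insert g A))
        \<le> worst_removal v (K - Suc x) (G - insert g A)"
      by (rule worst_removal_Suc_insert) auto
    moreover have "insert g (G - insert g A) = G - A" "Suc (K - Suc x) = K - x"
      using assms that by auto
    ultimately show ?thesis
      using worst_removal_Suc_insert[OF assms(1,3), of x]
      unfolding t_def by (intro sgn_mono_real) simp
  qed
  have bound: "\<bar>t B x\<bar> \<le> 1" for B x by (simp add: t_def sgn_if)
  have "envy v K G (insert g A) = t (insert g A) 0 + (\<Sum>x<K. t (insert g A) (Suc x))"
    unfolding envy_eq lessThan_Suc_atMost[symmetric] by (rule sum.lessThan_Suc_shift)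
  also have "\<dots> \<le> 1 + (\<Sum>x<K. t A x)"
    using bound[of "insert g A" 0] shift by (intro add_mono sum_mono) auto
  also have "\<dots> = 1 + envy v K G A - t A K"
    unfolding envy_eq lessThan_Suc_atMost[symmetric] by simp
  finally show ?thesis using bound[of A K] by simp
qed

text \<open>If no index \<open>x\<close> had a nonpositive difference, all \<open>K + 1\<close>
  signs would be 1. At such an \<open>x\<close>, removing at most \<open>x\<close> goods brings
  \<open>A\<close> down to a value that is at most that of the untouched complement.\<close>

lemma envy_up_to:
  assumes "A \<subseteq> G" "envy v K G A < real K + 1"
  shows "\<exists>R\<subseteq>A. card R \<le> K \<and> v (G - A) \<ge> v (A - R)"
proof -
  have fin: "finite A" "finite (G - A)" using assms finite_goods by (auto intro: finite_subset)
  have "\<exists>x\<le>K. worst_removal v x A \<le> worst_removal v (K - x) (G - A)"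
  proof (rule ccontr)
    assume "\<not> ?thesis"
    then have "worst_removal v (K - x) (G - A) < worst_removal v x A" if "x \<le> K" for x
      using that by (meson not_le)
    then have "envy v K G A = (\<Sum>x\<le>K. 1)"
      unfolding envy_def by (intro sum.cong) (auto simp: sgn_pos)
    then show False using assms(2) by simp
  qed
  then obtain x where x: "x \<le> K" "worst_removal v x A \<le> worst_removal v (K - x) (G - A)" by blast
  obtain R where R: "R \<subseteq> A" "card R \<le> x" "worst_removal v x A = v (A - R)"
    using worst_removal_attained[OF fin(1)] .
  have "worst_removal v (K - x) (G - A) \<le> v (G - A - {})"
    using fin by (intro worst_removal_le) auto
  then show ?thesis using R x by (intro exI[of _ R]) auto
qed

end

section \<open>Bounded differences\<close>

lemma sum_PiE_insert:
  assumes "j \<notin> S"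
  shows "(\<Sum>t\<in>Pi\<^sub>E (insert j S) T. h t) = (\<Sum>t\<in>Pi\<^sub>E S T. \<Sum>y\<in>T j. h (t(j := y)))"
proof -
  have "(\<Sum>t\<in>Pi\<^sub>E (insert j S) T. h t) = (\<Sum>(y, t)\<in>T j \<times> Pi\<^sub>E S T. h (t(j := y)))"
    unfolding PiE_insert_eq
    by (subst sum.reindex[OF inj_combinator[OF assms]]) (simp add: case_prod_unfold comp_def)
  also have "\<dots> = (\<Sum>t\<in>Pi\<^sub>E S T. \<Sum>y\<in>T j. h (t(j := y)))"
    by (subst sum.swap) (rule sum.cartesian_product[symmetric])
  finally show ?thesis .
qed

text \<open>Termwise comparison of the power series.\<close>

lemma cosh_le_exp: "cosh x \<le> exp (x\<^sup>2 / 2)" for x :: real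
proof -
  have fact_le: "fact n * 2 ^ n \<le> (fact (2 * n) :: real)" for n
  proof (induction n)
    case (Suc n)
    have "(fact (Suc n) * 2 ^ Suc n :: real) = (fact n * 2 ^ n) * (2 * real n + 2)"
      by (simp add: algebra_simps)
    also have "\<dots> \<le> fact (2 * n) * ((2 * real n + 1) * (2 * real n + 2))"
      by (intro mult_mono Suc.IH) (auto simp: algebra_simps)
    also have "\<dots> = fact (2 * Suc n)" by (simp add: algebra_simps)
    finally show ?case .
  qed simp
  have cosh_sums: "(\<lambda>n. x ^ (2 * n) / fact (2 * n)) sums cosh x"
  proof -
    have "(\<lambda>n. (\<lambda>k. if even k then x ^ k /\<^sub>R fact k else 0) (2 * n)) sums cosh x"
      using cosh_converges[of x]
      by (subst sums_mono_reindex) (auto simp: strict_mono_def elim!: evenE)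
    then show ?thesis by (simp add: field_simps)
  qed
  have exp_sums: "(\<lambda>n. (x\<^sup>2 / 2) ^ n /\<^sub>R fact n) sums exp (x\<^sup>2 / 2)"
    by (rule exp_converges)
  show ?thesis
  proof (rule sums_le[OF _ cosh_sums exp_sums])
    fix n
    have scale: "w ^ n / (fact n * 2 ^ n) = (w / 2) ^ n /\<^sub>R fact n" for w :: real
      by (simp add: power_divide field_simps)
    have "x ^ (2 * n) / fact (2 * n) \<le> x ^ (2 * n) / (fact n * 2 ^ n)"
      by (intro divide_left_mono fact_le) auto
    also have "\<dots> = (x\<^sup>2 / 2) ^ n /\<^sub>R fact n"
      using scale[of "x\<^sup>2"] by (simp only: power_mult)
    finally show "x ^ (2 * n) / fact (2 * n) \<le> (x\<^sup>2 / 2) ^ n /\<^sub>R fact n" .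
  qed
qed

text \<open>By convexity, \<open>exp\<close> on the interval from \<open>- c\<close> to
  \<open>c\<close> lies below its chord.\<close>

lemma exp_le_chord:
  fixes y c :: real
  assumes "\<bar>y\<bar> \<le> c"
  shows "exp y \<le> cosh c + y / c * sinh c"
proof (cases "c = 0")
  case False
  then have c: "0 < c" using assms by linarith
  define z where "z = y / c"
  define a where "a = (1 + z) / 2"
  have "-c \<le> y" "y \<le> c" using assms by auto
  then have "-1 \<le> z" "z \<le> 1" using c by (simp_all add: z_def field_simps)
  then have "0 \<le> a" "a \<le> 1" by (auto simp: a_def)
  then have "exp ((1 - a) *\<^sub>R (- c) + a *\<^sub>R c) \<le> (1 - a) * exp (- c) + a * exp c"
    by (intro convex_onD[OF exp_convex]) auto
  moreover have "(1 - a) *\<^sub>R (- c) + a *\<^sub>R c = y"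
    using c by (simp add: a_def z_def field_simps)
  moreover have "(1 - a) * exp (- c) + a * exp c = cosh c + z * sinh c"
    unfolding a_def cosh_field_def sinh_field_def by (simp add: field_simps)
  ultimately show ?thesis by (simp add: z_def)
qed (use assms in simp)

text \<open>Hoeffding's lemma for a uniform choice from \<open>V\<close>: the linear part of the
  chord sums to zero.\<close>

lemma sum_exp_mean_zero_le:
  fixes y :: "'a \<Rightarrow> real"
  assumes "finite V" "\<And>v. v \<in> V \<Longrightarrow> \<bar>y v\<bar> \<le> c" "(\<Sum>v\<in>V. y v) = 0"
  shows "(\<Sum>v\<in>V. exp (y v)) \<le> card V * exp (c\<^sup>2 / 2)"
proof -
  have "(\<Sum>v\<in>V. exp (y v)) \<le> (\<Sum>v\<in>V. cosh c + y v / c * sinh c)"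
    by (intro sum_mono exp_le_chord assms)
  also have "\<dots> = card V * cosh c"
    using assms(3) by (simp add: sum.distrib flip: sum_distrib_right sum_divide_distrib)
  also have "\<dots> \<le> card V * exp (c\<^sup>2 / 2)" by (intro mult_left_mono cosh_le_exp) simp
  finally show ?thesis .
qed

text \<open>The exponential moment bound behind McDiarmid's inequality, for independent uniform
  coordinates. Averaging over coordinate \<open>j\<close> gives a function \<open>h\<close> with the
  same difference bounds on the rest, and \<open>g\<close> deviates from \<open>h\<close> by at most
  \<open>c j\<close>, so Hoeffding's lemma applies to that coordinate.\<close>

lemma sum_exp_bounded_differences:
  fixes g :: "('a \<Rightarrow> 'b) \<Rightarrow> real" and c :: "'a \<Rightarrow> real"
  assumes "finite S" "finite V" "V \<noteq> {}"
    and "\<And>t j v. t \<in> S \<rightarrow>\<^sub>E V \<Longrightarrow> j \<in> S \<Longrightarrow> v \<in> V \<Longrightarrow> \<bar>g (t(j := v)) - g t\<bar> \<le> c j"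
  shows "(\<Sum>t\<in>S \<rightarrow>\<^sub>E V. exp (g t)) \<le> real (card V) ^ card S *
    exp ((\<Sum>t\<in>S \<rightarrow>\<^sub>E V. g t) / real (card V) ^ card S + (\<Sum>j\<in>S. (c j)\<^sup>2 / 2))"
  using assms(1,4)
proof (induction S arbitrary: g rule: finite_induct)
  case empty
  show ?case by simp
next
  case (insert j S)
  define p where "p = real (card V)"
  have p: "0 < p" using assms(2,3) by (simp add: p_def card_gt_0_iff)
  define h where "h t = (\<Sum>v\<in>V. g (t(j := v))) / p" for t
  have avg_le: "\<bar>(\<Sum>v\<in>V. f v) / p\<bar> \<le> b" if "\<And>v. v \<in> V \<Longrightarrow> \<bar>f v\<bar> \<le> b" for f :: "'b \<Rightarrow> real" and b
  proof -
    have "\<bar>\<Sum>v\<in>V. f v\<bar> \<le> (\<Sum>v\<in>V. b)" by (intro order_trans[OF sum_abs] sum_mono that)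
    then show ?thesis using p by (simp add: p_def field_simps)
  qed
  have upd: "t(j := v) \<in> insert j S \<rightarrow>\<^sub>E V" if "t \<in> S \<rightarrow>\<^sub>E V" "v \<in> V" for t v
    using that by (rule PiE_fun_upd[rotated])
  have h_diff: "\<bar>h (t(i := v)) - h t\<bar> \<le> c i" if "t \<in> S \<rightarrow>\<^sub>E V" "i \<in> S" "v \<in> V" for t i v
  proof -
    have ij: "i \<noteq> j" using that insert.hyps by blast
    have "h (t(i := v)) - h t = (\<Sum>w\<in>V. g ((t(j := w))(i := v)) - g (t(j := w))) / p"
      by (simp add: h_def fun_upd_twist[OF ij] sum_subtractf diff_divide_distrib)
    also have "\<bar>\<dots>\<bar> \<le> c i"
      by (rule avg_le) (use that upd in \<open>auto intro!: insert.prems\<close>)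
    finally show ?thesis .
  qed
  have inner: "(\<Sum>v\<in>V. exp (g (t(j := v)))) \<le> exp (h t) * (p * exp ((c j)\<^sup>2 / 2))"
    if "t \<in> S \<rightarrow>\<^sub>E V" for t
  proof -
    have "\<bar>g (t(j := v)) - h t\<bar> \<le> c j" if "v \<in> V" for v
    proof -
      have "g (t(j := v)) - h t = (\<Sum>w\<in>V. g ((t(j := w))(j := v)) - g (t(j := w))) / p"
        using p by (simp add: h_def sum_subtractf diff_divide_distrib p_def)
      also have "\<bar>\<dots>\<bar> \<le> c j"
        by (rule avg_le) (rule insert.prems[OF upd[OF \<open>t \<in> _\<close>]], use that in simp_all)
      finally show ?thesis .
    qed
    moreover have "(\<Sum>v\<in>V. g (t(j := v)) - h t) = 0"
      using p by (simp add: h_def sum_subtractf p_def)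
    ultimately have "(\<Sum>v\<in>V. exp (g (t(j := v)) - h t)) \<le> p * exp ((c j)\<^sup>2 / 2)"
      unfolding p_def using assms(2) by (intro sum_exp_mean_zero_le) auto
    then have "exp (h t) * (\<Sum>v\<in>V. exp (g (t(j := v)) - h t)) \<le> exp (h t) * (p * exp ((c j)\<^sup>2 / 2))"
      by (rule mult_left_mono) simp
    then show ?thesis by (simp add: sum_distrib_left flip: exp_add)
  qed
  let ?P = "p ^ card S"
  have "(\<Sum>t\<in>insert j S \<rightarrow>\<^sub>E V. exp (g t)) = (\<Sum>t\<in>S \<rightarrow>\<^sub>E V. \<Sum>v\<in>V. exp (g (t(j := v))))"
    by (rule sum_PiE_insert[OF insert.hyps(2)])
  also have "\<dots> \<le> (\<Sum>t\<in>S \<rightarrow>\<^sub>E V. exp (h t) * (p * exp ((c j)\<^sup>2 / 2)))"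
    by (intro sum_mono inner)
  also have "\<dots> = (\<Sum>t\<in>S \<rightarrow>\<^sub>E V. exp (h t)) * (p * exp ((c j)\<^sup>2 / 2))"
    by (simp add: sum_distrib_right)
  also have "\<dots> \<le> (?P * exp ((\<Sum>t\<in>S \<rightarrow>\<^sub>E V. h t) / ?P + (\<Sum>j\<in>S. (c j)\<^sup>2 / 2))) * (p * exp ((c j)\<^sup>2 / 2))"
    unfolding p_def[symmetric] using p
    by (intro mult_right_mono insert.IH[folded p_def] h_diff) auto
  also have "(\<Sum>t\<in>S \<rightarrow>\<^sub>E V. h t) = (\<Sum>t\<in>insert j S \<rightarrow>\<^sub>E V. g t) / p"
    by (simp add: h_def sum_PiE_insert[OF insert.hyps(2)] sum_divide_distrib)
  finally show ?case
    using insert.hyps by (simp add: p_def[symmetric] exp_add mult_ac)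
qed

text \<open>Each coordinate of a uniform draw is itself uniform.\<close>

lemma sum_PiE_coordinate:
  fixes h :: "'b \<Rightarrow> real"
  assumes "finite S" "finite V" "j \<in> S"
  shows "real (card V) * (\<Sum>t\<in>S \<rightarrow>\<^sub>E V. h (t j)) = real (card V) ^ card S * (\<Sum>v\<in>V. h v)"
proof -
  obtain S' where S': "S = insert j S'" "j \<notin> S'" using assms(3) by (meson mk_disjoint_insert)
  then have fin: "finite S'" using assms(1) by simp
  have "(\<Sum>t\<in>S \<rightarrow>\<^sub>E V. h (t j)) = real (card (S' \<rightarrow>\<^sub>E V)) * (\<Sum>v\<in>V. h v)"
    unfolding S'(1) sum_PiE_insert[OF S'(2)] by simp
  also have "real (card (S' \<rightarrow>\<^sub>E V)) = real (card V) ^ card S'"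
    using fin by (simp add: card_PiE)
  finally show ?thesis using S' fin by simp
qed

section \<open>Consensus halving\<close>

text \<open>The topological part yields beads \<open>P\<close> for which every \<open>f i\<close>
  has mean between -1 and 0 while at most \<open>n\<close> goods influence the draw. Averaging
  \<open>2 * n\<close> exponential moments then selects one draw that is good for all
  \<open>i\<close>.\<close>

theorem nonadditive_discrepancy:
  fixes f :: "nat \<Rightarrow> nat set \<Rightarrow> real"
  assumes n: "2 \<le> n" and m: "1 \<le> m"
    and mono: "\<And>i. i < n \<Longrightarrow> mono_on (Pow {1..m}) (f i)"
    and odd: "\<And>i A. i < n \<Longrightarrow> A \<subseteq> {1..m} \<Longrightarrow> f i ({1..m} - A) = - f i A"
    and lipschitz: "\<And>i A g. i < n \<Longrightarrow> A \<subseteq> {1..m} \<Longrightarrow> g \<in> {1..m} \<Longrightarrow> g \<notin> A \<Longrightarrow>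
      f i (insert g A) \<le> f i A + 2"
  obtains A where "A \<subseteq> {1..m}" "\<And>i. i < n \<Longrightarrow> \<bar>f i A\<bar> \<le> 4 * sqrt (real n * ln (real n)) + 1"
proof -
  \<comment> \<open>With \<open>2 * n\<close> beads per good, the at most \<open>n\<close> zero
    beads are drawn at most half a time on average; as each hit costs 2, the mean shifts by at most
    1.\<close>
  define q where "q = 2 * n"
  define N where "N = m * q"
  define S where "S = {1..m}"
  define V where "V = {1..q}"
  define bead where "bead j v = (j - 1) * q + v" for j v :: nat
  define block where "block z = Suc ((z - 1) div q)" for z
  define chosen where "chosen B t = {j \<in> S. bead j (t j) \<in> B}" for B t
  define w where "w = real (card V) ^ card S"
  have q: "0 < q" "card V = q" using n by (simp_all add: q_def V_def)
  then have w: "0 < w" "card (S \<rightarrow>\<^sub>E V) = w" by (simp_all add: w_def S_def card_PiE)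
  have finite: "finite S" "finite V" "V \<noteq> {}" using q by (auto simp: S_def V_def)
  have chosen_sub: "chosen B t \<subseteq> {1..m}" for B t by (auto simp: chosen_def S_def)
  have bead_upper: "bead j v \<le> j * q" if "j \<in> S" "v \<in> V" for j v
    using that by (cases j) (auto simp: bead_def S_def V_def)
  have block_upper: "j * q \<le> N" if "j \<in> S" for j
    using that by (simp add: S_def N_def)
  have bead_range: "bead j v \<in> {1..N}" if "j \<in> S" "v \<in> V" for j v
    using bead_upper[OF that] block_upper[OF that(1)] that(2) by (auto simp: bead_def V_def)
  have block_eq: "block z = j" if j: "j \<in> S" and z: "z \<in> {(j - 1) * q<..j * q}" for j z
  proof -
    obtain v where v: "z = (j - 1) * q + Suc v" using z by (auto dest: less_imp_Suc_add)
    have "j * q = (j - 1) * q + q" using j by (cases j) (auto simp: S_def)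
    then have "v < q" using z v by simp
    then show ?thesis using j q by (simp add: block_def v S_def)
  qed
  have bead_in_block: "bead j v \<in> {(j - 1) * q<..j * q}" if "j \<in> S" "v \<in> V" for j v
    using bead_upper[OF that] that(2) by (auto simp: bead_def V_def)

  define F where "F i B = (\<Sum>t\<in>S \<rightarrow>\<^sub>E V. f i (chosen B t))" for i B
  have F_mono: "mono_on (Pow {1..N}) (F i)" if "i < n" for i
    unfolding F_def
    using chosen_sub
    by (intro mono_onI sum_mono mono_onD[OF mono[OF that]]) (auto simp: chosen_def)
  have F_odd: "F i ({1..N} - B) = - F i B" if "i < n" for i B
  proof -
    have "f i (chosen ({1..N} - B) t) = - f i (chosen B t)" if t: "t \<in> S \<rightarrow>\<^sub>E V" for t
    proof -
      have "chosen ({1..N} - B) t = {1..m} - chosen B t"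
        using bead_range t by (auto simp: chosen_def S_def PiE_iff simp del: atLeastAtMost_iff)
      then show ?thesis using odd[OF \<open>i < n\<close> chosen_sub] by simp
    qed
    then show ?thesis by (simp add: F_def sum_negf)
  qed
  have "n < N" using n m by (simp add: N_def q_def)
  obtain X where X: "X \<in> signed_sets N" "card (breaks X N) \<le> n"
    and F_pos: "\<And>i. i < n \<Longrightarrow> F i (positive_part X) \<le> 0"
    and F_neg: "\<And>i. i < n \<Longrightarrow> F i (positive_part (uminus ` X)) \<le> 0"
    using undecided_with_few_breaks[of n N F] F_mono F_odd \<open>n < N\<close> by blast
  define P where "P = positive_part X"
  define Z where "Z = {j \<in> {1..N}. int j \<notin> X \<and> - int j \<notin> X}"
  have "Z \<subseteq> breaks X N" unfolding Z_def using zero_in_breaks by blast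
  moreover have finite_breaks: "finite (breaks X N)" by (simp add: breaks_def)
  ultimately have card_Z: "card Z \<le> n" using X(2) card_mono le_trans by blast
  have P_Z: "{1..N} - positive_part (uminus ` X) = P \<union> Z"
  proof -
    have "int j \<in> X \<Longrightarrow> - int j \<notin> X \<and> j \<in> {1..N}" for j
      using X(1) unfolding signed_sets_def by (cases j) auto
    then show ?thesis
      by (auto simp: P_def Z_def positive_part_def in_uminus_image_iff)
  qed

  have f_Un: "f i (A \<union> B) \<le> f i A + 2 * real (card B)"
    if "i < n" "A \<subseteq> {1..m}" "B \<subseteq> {1..m}" for i A B
  proof -
    have "finite B" using that(3) finite_subset by blast
    then show ?thesis
      using that(3)
    proof (induction B)
      case (insert g B)
      then have "f i (insert g (A \<union> B)) \<le> f i (A \<union> B) + 2"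
        using lipschitz[OF that(1), of "A \<union> B" g] that(2) by (cases "g \<in> A \<union> B") (auto simp: insert_absorb)
      then show ?case using insert by simp
    qed simp
  qed
  \<comment> \<open>Linearity of expectation: a given bead is drawn with probability
    \<open>1 / q\<close>.\<close>
  have hits: "2 * (\<Sum>t\<in>S \<rightarrow>\<^sub>E V. real (card (chosen Z t))) \<le> w"
  proof -
    have "real q * (\<Sum>t\<in>S \<rightarrow>\<^sub>E V. real (card (chosen Z t))) =
        real q * (\<Sum>t\<in>S \<rightarrow>\<^sub>E V. \<Sum>j\<in>S. of_bool (bead j (t j) \<in> Z))"
      using finite by (simp add: chosen_def Int_def)
    also have "\<dots> = (\<Sum>j\<in>S. real q * (\<Sum>t\<in>S \<rightarrow>\<^sub>E V. of_bool (bead j (t j) \<in> Z)))"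
      by (subst sum.swap) (simp add: sum_distrib_left)
    also have "\<dots> = (\<Sum>j\<in>S. w * (\<Sum>v\<in>V. of_bool (bead j v \<in> Z)))"
      using sum_PiE_coordinate[OF finite(1,2)]
      unfolding w_def q(2) by (intro sum.cong refl)
    also have "\<dots> = w * (\<Sum>(j, v)\<in>S \<times> V. of_bool (bead j v \<in> Z))"
      by (simp add: sum_distrib_left sum.cartesian_product case_prod_unfold)
    also have "(\<Sum>(j, v)\<in>S \<times> V. of_bool (bead j v \<in> Z)) =
        real (card {x \<in> S \<times> V. bead (fst x) (snd x) \<in> Z})"
      using finite by (simp add: case_prod_unfold Int_def)
    also have "card {x \<in> S \<times> V. bead (fst x) (snd x) \<in> Z} \<le> card Z"
    proof (rule card_inj_on_le)
      show "inj_on (\<lambda>x. bead (fst x) (snd x)) {x \<in> S \<times> V. bead (fst x) (snd x) \<in> Z}"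
      proof (rule inj_onI)
        fix x y
        assume x: "x \<in> {x \<in> S \<times> V. bead (fst x) (snd x) \<in> Z}"
          and y: "y \<in> {x \<in> S \<times> V. bead (fst x) (snd x) \<in> Z}"
          and eq: "bead (fst x) (snd x) = bead (fst y) (snd y)"
        have "fst x = fst y"
          using x y eq block_eq[OF _ bead_in_block, of "fst x" "snd x"]
            block_eq[OF _ bead_in_block, of "fst y" "snd y"] by auto
        then show "x = y" using eq by (simp add: bead_def prod_eq_iff)
      qed
    qed (auto simp: Z_def)
    finally have "real q * (\<Sum>t\<in>S \<rightarrow>\<^sub>E V. real (card (chosen Z t))) \<le> w * card Z"
      using w by simp
    also have "\<dots> \<le> w * n" using w card_Z by simp
    finally show ?thesis using n by (simp add: q_def mult.commute[of w])
  qed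
  \<comment> \<open>The bound for the negative part says, by oddness, that \<open>F i\<close> is
    nonnegative once the zero beads join \<open>P\<close>; leaving them out again costs at most
    \<open>w\<close> in total.\<close>
  have F_lower: "- w \<le> F i P" if "i < n" for i
  proof -
    have "0 \<le> F i (P \<union> Z)"
      using F_odd[OF that, of "positive_part (uminus ` X)"] F_neg[OF that]
      unfolding P_Z by linarith
    also have "\<dots> = (\<Sum>t\<in>S \<rightarrow>\<^sub>E V. f i (chosen P t \<union> chosen Z t))"
    proof -
      have "chosen (P \<union> Z) t = chosen P t \<union> chosen Z t" for t by (auto simp: chosen_def)
      then show ?thesis by (simp add: F_def)
    qed
    also have "\<dots> \<le> (\<Sum>t\<in>S \<rightarrow>\<^sub>E V. f i (chosen P t) + 2 * real (card (chosen Z t)))"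
      by (intro sum_mono f_Un that chosen_sub)
    also have "\<dots> = F i P + 2 * (\<Sum>t\<in>S \<rightarrow>\<^sub>E V. real (card (chosen Z t)))"
      by (simp add: F_def sum.distrib sum_distrib_left)
    finally show ?thesis using hits by simp
  qed

  \<comment> \<open>The goods whose block contains a break: only these can have beads both inside
    and outside \<open>P\<close>.\<close>
  define D where "D = {j \<in> S. {(j - 1) * q<..j * q} \<inter> breaks X N \<noteq> {}}"
  have card_D: "card D \<le> n"
  proof -
    have "D \<subseteq> block ` breaks X N" unfolding D_def using block_eq by blast
    then have "card D \<le> card (breaks X N)" using finite_breaks surj_card_le by blast
    then show ?thesis using X(2) by simp
  qed
  have chosen_const: "chosen P (t(j := v)) = chosen P t"
    if "t \<in> S \<rightarrow>\<^sub>E V" "j \<in> S" "v \<in> V" "j \<notin> D" for t j v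
  proof -
    have "bead j v \<in> P \<longleftrightarrow> bead j (t j) \<in> P"
      using interval_constant[of "(j - 1) * q" "j * q" X N] bead_in_block[of j v]
        bead_in_block[of j "t j"] block_upper[of j] that
      by (auto simp: D_def P_def positive_part_def PiE_iff simp del: greaterThanAtMost_iff)
    then show ?thesis by (auto simp: chosen_def)
  qed
  have f_diff: "\<bar>f i (chosen P (t(j := v))) - f i (chosen P t)\<bar> \<le> 2 * of_bool (j \<in> D)"
    if "i < n" "t \<in> S \<rightarrow>\<^sub>E V" "j \<in> S" "v \<in> V" for i t j v
  proof (cases "j \<in> D")
    case True
    let ?A = "chosen P (t(j := v))" and ?B = "chosen P t"
    have le: "f i A \<le> f i B + 2" if "A \<subseteq> insert j B" "A \<subseteq> {1..m}" "B \<subseteq> {1..m}" for A B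
    proof -
      have "f i A \<le> f i (B \<union> {j})"
        using that \<open>j \<in> S\<close> by (intro mono_onD[OF mono[OF \<open>i < n\<close>]]) (auto simp: S_def)
      also have "\<dots> \<le> f i B + 2"
        using f_Un[OF \<open>i < n\<close>, of B "{j}"] that \<open>j \<in> S\<close> by (simp add: S_def)
      finally show ?thesis .
    qed
    have "?A \<subseteq> insert j ?B" "?B \<subseteq> insert j ?A" by (auto simp: chosen_def)
    then show ?thesis
      using le[of ?A ?B] le[of ?B ?A] chosen_sub True by (simp add: abs_le_iff)
  qed (use chosen_const that in simp)

  \<comment> \<open>Each good in \<open>D\<close> contributes \<open>(2 * r)\<^sup>2 / 2\<close> to
    the exponent, so this \<open>r\<close> keeps their total at \<open>2 * ln n\<close> or less,
    matching the logarithmic cost of the union bound.\<close>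
  define r where "r = sqrt (ln n / n)"
  have ln_n: "0 < ln (real n)" using n by simp
  have r: "0 < r" "r\<^sup>2 * n = ln n" using ln_n n by (simp_all add: r_def)
  have mgf: "(\<Sum>t\<in>S \<rightarrow>\<^sub>E V. exp (s * r * f i (chosen P t))) \<le> w * exp (r + 2 * ln n)"
    if "i < n" "\<bar>s\<bar> = 1" for i and s :: real
  proof -
    have "(\<Sum>t\<in>S \<rightarrow>\<^sub>E V. exp (s * r * f i (chosen P t))) \<le> w *
      exp ((\<Sum>t\<in>S \<rightarrow>\<^sub>E V. s * r * f i (chosen P t)) / w + (\<Sum>j\<in>S. (r * (2 * of_bool (j \<in> D)))\<^sup>2 / 2))"
      unfolding w_def
    proof (rule sum_exp_bounded_differences[OF finite])
      fix t j v assume "t \<in> S \<rightarrow>\<^sub>E V" "j \<in> S" "v \<in> V"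
      then have "r * \<bar>f i (chosen P (t(j := v))) - f i (chosen P t)\<bar> \<le> r * (2 * of_bool (j \<in> D))"
        using r(1) that(1) by (intro mult_left_mono f_diff) auto
      moreover have "\<bar>s * r * f i (chosen P (t(j := v))) - s * r * f i (chosen P t)\<bar> =
          r * \<bar>f i (chosen P (t(j := v))) - f i (chosen P t)\<bar>"
        using that(2) r(1) by (simp add: abs_mult flip: right_diff_distrib)
      ultimately show "\<bar>s * r * f i (chosen P (t(j := v))) - s * r * f i (chosen P t)\<bar>
          \<le> r * (2 * of_bool (j \<in> D))" by simp
    qed
    also have "\<dots> \<le> w * exp (r + 2 * ln n)"
    proof -
      have "(\<Sum>t\<in>S \<rightarrow>\<^sub>E V. s * r * f i (chosen P t)) = r * (s * F i P)"
        by (simp add: F_def sum_distrib_left mult_ac)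
      also have "\<dots> \<le> r * w"
        using F_pos[OF that(1)] F_lower[OF that(1)] that(2) r(1) w(1)
        by (intro mult_left_mono) (auto simp: P_def abs_if split: if_splits)
      finally have "(\<Sum>t\<in>S \<rightarrow>\<^sub>E V. s * r * f i (chosen P t)) / w \<le> r"
        using w(1) by (simp add: field_simps)
      moreover have "(\<Sum>j\<in>S. (r * (2 * of_bool (j \<in> D)))\<^sup>2 / 2) \<le> 2 * ln n"
      proof -
        have "(\<Sum>j\<in>S. (r * (2 * of_bool (j \<in> D)))\<^sup>2 / 2) = (\<Sum>j\<in>S. 2 * r\<^sup>2 * of_bool (j \<in> D))"
          by (intro sum.cong) (auto simp: power2_eq_square)
        also have "\<dots> = 2 * r\<^sup>2 * card D"
        proof -
          have "S \<inter> {j. j \<in> D} = D" by (auto simp: D_def)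
          then show ?thesis using finite by (simp flip: sum_distrib_left)
        qed
        also have "\<dots> \<le> 2 * r\<^sup>2 * n" using card_D by (intro mult_left_mono) auto
        finally show ?thesis using r(2) by simp
      qed
      ultimately show ?thesis using w(1) by simp
    qed
    finally show ?thesis .
  qed

  let ?cost = "\<lambda>t. \<Sum>i<n. exp (r * f i (chosen P t)) + exp (- r * f i (chosen P t))"
  have "\<exists>t\<in>S \<rightarrow>\<^sub>E V. ?cost t \<le> 2 * n * exp (r + 2 * ln n)"
  proof (rule ccontr)
    assume "\<not> ?thesis"
    then have "(\<Sum>t\<in>S \<rightarrow>\<^sub>E V. 2 * n * exp (r + 2 * ln n)) < (\<Sum>t\<in>S \<rightarrow>\<^sub>E V. ?cost t)"
      using finite by (intro sum_strict_mono) (auto simp: finite_PiE PiE_eq_empty_iff)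
    also have "\<dots> = (\<Sum>i<n. (\<Sum>t\<in>S \<rightarrow>\<^sub>E V. exp (1 * r * f i (chosen P t))) +
        (\<Sum>t\<in>S \<rightarrow>\<^sub>E V. exp ((- 1) * r * f i (chosen P t))))"
      by (subst sum.swap) (simp add: sum.distrib)
    also have "\<dots> \<le> (\<Sum>i<n. w * exp (r + 2 * ln n) + w * exp (r + 2 * ln n))"
      by (intro sum_mono add_mono mgf) auto
    finally show False using w(2) by simp
  qed
  then obtain t where t: "?cost t \<le> 2 * n * exp (r + 2 * ln n)" by blast
  show thesis
  proof (rule that[OF chosen_sub[of P t]])
    fix i assume i: "i < n"
    let ?x = "f i (chosen P t)"
    have "exp (r * \<bar>?x\<bar>) \<le> exp (r * ?x) + exp (- r * ?x)" by (simp add: abs_if)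
    also have "\<dots> \<le> ?cost t" using i by (intro member_le_sum) (auto intro: add_nonneg_nonneg)
    \<comment> \<open>Since \<open>2 \<le> n\<close>, the factor \<open>2 * n\<close> is absorbed
      into \<open>exp (2 * ln n)\<close>.\<close>
    also have "\<dots> \<le> n * n * exp (r + 2 * ln n)"
      using t n by (elim order_trans) (intro mult_right_mono, simp_all)
    also have "\<dots> = exp (r + 4 * ln n)"
    proof -
      have "real n * real n = exp (2 * ln n)" using n by (simp only: mult_2 exp_add) simp
      then show ?thesis by (simp flip: exp_add)
    qed
    finally have "r * \<bar>?x\<bar> \<le> r + 4 * ln n" by simp
    moreover have "r * sqrt (n * ln n) = ln n"
      using n ln_n by (simp add: r_def flip: real_sqrt_mult power2_eq_square)
    ultimately have "r * \<bar>?x\<bar> \<le> r * (4 * sqrt (n * ln n) + 1)" by (simp add: algebra_simps)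
    then show "\<bar>?x\<bar> \<le> 4 * sqrt (real n * ln (real n)) + 1" using r(1) by simp
  qed
qed

theorem theorem3:
  shows "\<exists>C::real. C > 0 \<and>
    (\<forall>(n::nat) (m::nat) (u :: nat \<Rightarrow> nat set \<Rightarrow> real).
       n \<ge> 2 \<longrightarrow> m \<ge> 1 \<longrightarrow> (\<forall>i\<in>{1..n}. monotone_utility m (u i)) \<longrightarrow>
       (\<exists>(c::nat) A1 A2. real c \<le> C * sqrt (real n * ln (real n)) \<and>
          partition_of_goods m A1 A2 \<and> consensus_halving_up_to c n u A1 A2))"
\<comment> \<open>With \<open>K\<close> the floor of \<open>5 * s\<close>, \<open>envy_up_to\<close>
  needs \<open>4 * s + 1 < K + 1\<close>. This holds because \<open>s\<close> is at least 1, which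
  follows from \<open>ln n \<ge> 1 / 2\<close>.\<close>
proof (rule exI[of _ 5], intro conjI allI impI)
  fix n m :: nat and u :: "nat \<Rightarrow> nat set \<Rightarrow> real"
  assume n: "n \<ge> 2" and m: "m \<ge> 1" and "\<forall>i\<in>{1..n}. monotone_utility m (u i)"
  then have mono: "mono_on (Pow {1..m}) (u (Suc i))" if "i < n" for i
    using that by (simp add: monotone_utility_def)
  define s where "s = sqrt (real n * ln (real n))"
  define K where "K = nat \<lfloor>5 * s\<rfloor>"
  let ?G = "{1..m}"
  let ?f = "\<lambda>i. envy (u (Suc i)) K ?G"
  have "1 / 2 \<le> ln (real n)"
  proof -
    have "ln (1 / real n) \<le> 1 / real n - 1" using n by (intro ln_le_minus_one) simp
    moreover have "1 / real n \<le> 1 / 2" using n by (simp add: field_simps)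
    moreover have "ln (1 / real n) = - ln (real n)" using n by (simp add: ln_div)
    ultimately show ?thesis by linarith
  qed
  then have "2 * (1 / 2) \<le> real n * ln (real n)" using n by (intro mult_mono) auto
  then have "1 \<le> s" by (simp add: s_def)
  then have K: "real K \<le> 5 * s" "4 * s + 1 < real K + 1" by (simp_all add: K_def) linarith+
  obtain A where A: "A \<subseteq> ?G" and small: "\<And>i. i < n \<Longrightarrow> \<bar>?f i A\<bar> \<le> 4 * s + 1"
    unfolding s_def
  proof (rule nonadditive_discrepancy[OF n m, of ?f])
    fix i assume i: "i < n"
    show "mono_on (Pow ?G) (?f i)"
      by (intro mono_onI envy_mono[OF _ mono[OF i]]) auto
    show "?f i (?G - A) = - ?f i A" if "A \<subseteq> ?G" for A
      using that by (rule envy_complement[OF finite_atLeastAtMost mono[OF i]])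
    show "?f i (insert g A) \<le> ?f i A + 2" if "A \<subseteq> ?G" "g \<in> ?G" "g \<notin> A" for g A
      using that by (rule envy_insert_le[OF finite_atLeastAtMost mono[OF i]])
  qed blast
  show "\<exists>c A1 A2. real c \<le> 5 * sqrt (real n * ln (real n)) \<and>
      partition_of_goods m A1 A2 \<and> consensus_halving_up_to c n u A1 A2"
  proof (intro exI conjI)
    show "real K \<le> 5 * sqrt (real n * ln (real n))" using K(1) by (simp add: s_def)
    show "partition_of_goods m A (?G - A)" using A by (auto simp: partition_of_goods_def)
    show "consensus_halving_up_to K n u A (?G - A)"
      unfolding consensus_halving_up_to_def
    proof
      fix i assume "i \<in> {1..n}"
      then obtain i' where i: "i = Suc i'" "i' < n" by (cases i) auto
      \<comment> \<open>Applied to \<open>A\<close> and to its complement, this gives the two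
        inequalities of the halving.\<close>
      note up_to = envy_up_to[OF finite_atLeastAtMost mono[OF i(2)], where K = K]
      have "?f i' (?G - A) = - ?f i' A"
        by (rule envy_complement[OF finite_atLeastAtMost mono[OF i(2)] A])
      then have "?f i' A < real K + 1" "?f i' (?G - A) < real K + 1"
        using small[OF i(2)] K(2) by linarith+
      moreover have "?G - (?G - A) = A" using A by blast
      ultimately show "\<exists>R1 R2. R1 \<subseteq> A \<and> R2 \<subseteq> ?G - A \<and> card R1 \<le> K \<and> card R2 \<le> K \<and>
          u i (?G - A - R2) \<le> u i A \<and> u i (A - R1) \<le> u i (?G - A)"
        using up_to[OF A] up_to[of "?G - A"] unfolding i(1) by auto
    qed
  qed
qed simp

end
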